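(* Let $\mathcal{H}$ be a complex Hilbert space of dimension $d\ge 1$ with orthonormal bases $\mathcal{A}=\{|a_i\rangle\}_{i=0}^{d-1}$ and $\mathcal{B}=\{|b_j\rangle\}_{j=0}^{d-1}$ whose transition matrix is the discrete Fourier transform matrix, i.e. $\langle a_i|b_j\rangle=\frac{1}{\sqrt d}\,\omega_d^{ij}$ for all $i,j\in\{0,\dots,d-1\}$, where $\omega_d=e^{2\pi\sqrt{-1}/d}$. Then a state $|\psi\rangle\in\mathcal{H}$ is KD nonclassical (with respect to $\mathcal{A},\mathcal{B}$) if and only if $n_{\mathcal{A}}(\psi)\,n_{\mathcal{B}}(\psi)>d$. In other words, $|\psi\rangle$ is KD classical if and only if $n_{\mathcal{A}}(\psi)\,n_{\mathcal{B}}(\psi)=d$.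
   Context: A state is a unit vector $|\psi\rangle\in\mathcal{H}$. Its Kirkwood-Dirac (KD) distribution with respect to the orthonormal bases $\mathcal{A},\mathcal{B}$ is $Q_{ij}=\langle a_i|\psi\rangle\langle\psi|b_j\rangle\langle b_j|a_i\rangle$ for $i,j\in\{0,\dots,d-1\}$ (complex numbers in general). The state is called KD classical if every $Q_{ij}$ is real and nonnegative, and KD nonclassical otherwise. The support sizes are $n_{\mathcal{A}}(\psi)=|\{i:\langle a_i|\psi\rangle\neq 0\}|$ and $n_{\mathcal{B}}(\psi)=|\{j:\langle b_j|\psi\rangle\neq 0\}|$. *)

theory Defs
  imports Complex_Main
begin

text \<open>Physics convention: conjugate-linear in the first argument, linear in the second.
  Conjugate-linearity in the first argument follows from the conjugate symmetry.
  Completeness is not required, since it is automatic in the finite-dimensional case.\<close>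

locale complex_inner_product_space = vector_space scale
  for scale :: "complex \<Rightarrow> 'h::ab_group_add \<Rightarrow> 'h" +
  fixes braket :: "'h \<Rightarrow> 'h \<Rightarrow> complex"
  assumes braket_add_right: "braket x (y + z) = braket x y + braket x z"
    and braket_scale_right: "braket x (scale c y) = c * braket x y"
    and braket_commute: "braket y x = cnj (braket x y)"
    and braket_pos: "x \<noteq> 0 \<Longrightarrow> 0 < Re (braket x x)"

definition orthonormal_basis ::
  "(complex \<Rightarrow> 'h::ab_group_add \<Rightarrow> 'h) \<Rightarrow> ('h \<Rightarrow> 'h \<Rightarrow> complex) \<Rightarrow> nat \<Rightarrow> (nat \<Rightarrow> 'h) \<Rightarrow> bool"
  where "orthonormal_basis scale braket d e \<longleftrightarrow>
    (\<forall>i<d. \<forall>j<d. braket (e i) (e j) = (if i = j then 1 else 0)) \<and>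
    module.span scale (e ` {..<d}) = UNIV"

definition is_state :: "('h \<Rightarrow> 'h \<Rightarrow> complex) \<Rightarrow> 'h \<Rightarrow> bool"
  where "is_state braket \<psi> \<longleftrightarrow> braket \<psi> \<psi> = 1"

definition KD_distribution ::
  "('h \<Rightarrow> 'h \<Rightarrow> complex) \<Rightarrow> (nat \<Rightarrow> 'h) \<Rightarrow> (nat \<Rightarrow> 'h) \<Rightarrow> 'h \<Rightarrow> nat \<Rightarrow> nat \<Rightarrow> complex"
  where "KD_distribution braket a b \<psi> i j =
    braket (a i) \<psi> * braket \<psi> (b j) * braket (b j) (a i)"

definition KD_classical ::
  "('h \<Rightarrow> 'h \<Rightarrow> complex) \<Rightarrow> nat \<Rightarrow> (nat \<Rightarrow> 'h) \<Rightarrow> (nat \<Rightarrow> 'h) \<Rightarrow> 'h \<Rightarrow> bool"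
  where "KD_classical braket d a b \<psi> \<longleftrightarrow>
    (\<forall>i<d. \<forall>j<d. KD_distribution braket a b \<psi> i j \<in> \<real> \<and>
                  0 \<le> Re (KD_distribution braket a b \<psi> i j))"

definition KD_nonclassical ::
  "('h \<Rightarrow> 'h \<Rightarrow> complex) \<Rightarrow> nat \<Rightarrow> (nat \<Rightarrow> 'h) \<Rightarrow> (nat \<Rightarrow> 'h) \<Rightarrow> 'h \<Rightarrow> bool"
  where "KD_nonclassical braket d a b \<psi> \<longleftrightarrow> \<not> KD_classical braket d a b \<psi>"

definition support_size :: "('h \<Rightarrow> 'h \<Rightarrow> complex) \<Rightarrow> nat \<Rightarrow> (nat \<Rightarrow> 'h) \<Rightarrow> 'h \<Rightarrow> nat"
  where "support_size braket d e \<psi> = card {i. i < d \<and> braket (e i) \<psi> \<noteq> 0}"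

definition omega :: "nat \<Rightarrow> complex"
  where "omega d = exp (2 * complex_of_real pi * \<i> / of_nat d)"

end

theory Submission
  imports Defs "HOL-Analysis.Convex"
begin

text \<open>The argument uses only that the two bases are mutually unbiased. Put
  \<open>F i = \<bar>\<langle>a i|\<psi>\<rangle>\<bar>\<close> and \<open>G j = \<bar>\<langle>b j|\<psi>\<rangle>\<bar>\<close>, so that \<open>\<bar>Q i j\<bar> = F i * G j / sqrt d\<close>, while the
  marginals of \<open>Q\<close> are \<open>F i ^ 2\<close> and \<open>G j ^ 2\<close>. By Cauchy--Schwarz on the supports,
  \<open>1 = (\<Sum>Q) \<le> (\<Sum>\<bar>Q\<bar>) \<le> sqrt (n\<^sub>A * n\<^sub>B / d)\<close>; hence \<open>n\<^sub>A * n\<^sub>B \<ge> d\<close>, and equality forces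
  \<open>Q = \<bar>Q\<bar>\<close>. Conversely, if \<open>Q = \<bar>Q\<bar>\<close>, the marginals show that \<open>F\<close> and \<open>G\<close> are constant on
  their supports, with values related by \<open>F = n\<^sub>B * G / sqrt d\<close> and \<open>G = n\<^sub>A * F / sqrt d\<close>.\<close>

section \<open>Finite sums: Cauchy-Schwarz on a support, and equality cases\<close>

lemma sum_squared_le_card_support:
  fixes f :: "'i \<Rightarrow> real"
  assumes "finite A"
  shows "(\<Sum>i\<in>A. f i)\<^sup>2 \<le> real (card {i\<in>A. f i \<noteq> 0}) * (\<Sum>i\<in>A. (f i)\<^sup>2)"
proof -
  let ?S = "{i\<in>A. f i \<noteq> 0}"
  have "(\<Sum>i\<in>A. f i) = (\<Sum>i\<in>?S. f i)" "(\<Sum>i\<in>A. (f i)\<^sup>2) = (\<Sum>i\<in>?S. (f i)\<^sup>2)"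
    using assms by (auto intro!: sum.mono_neutral_right)
  then show ?thesis
    using sum_squared_le_sum_of_squares[of f ?S] by (simp add: mult.commute)
qed

lemma complex_eq_cmod_iff: "z = complex_of_real (cmod z) \<longleftrightarrow> z \<in> \<real> \<and> 0 \<le> Re z"
  by (auto simp: complex_is_Real_iff complex_eq_iff cmod_eq_Re)

text \<open>Equality case of the triangle inequality: the gaps \<open>cmod (f x) - Re (f x)\<close>
  are nonnegative and their sum is at most 0, so each of them vanishes.\<close>

lemma eq_cmod_if_sum_cmod_le_Re_sum:
  assumes "finite A" and "(\<Sum>x\<in>A. cmod (f x)) \<le> Re (\<Sum>x\<in>A. f x)" and "x \<in> A"
  shows "f x = complex_of_real (cmod (f x))"
proof -
  have "(\<Sum>x\<in>A. cmod (f x) - Re (f x)) \<le> 0"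
    using assms(2) by (simp add: sum_subtractf)
  moreover have nn: "0 \<le> cmod (f x) - Re (f x)" for x
    by (simp add: complex_Re_le_cmod)
  ultimately have "(\<Sum>x\<in>A. cmod (f x) - Re (f x)) = 0"
    by (intro antisym sum_nonneg)
  then have "cmod (f x) = Re (f x)"
    using sum_nonneg_eq_0_iff[OF \<open>finite A\<close>, of "\<lambda>x. cmod (f x) - Re (f x)"] nn \<open>x \<in> A\<close> by auto
  moreover from this have "Im (f x) = 0"
    using cmod_power2[of "f x"] by simp
  ultimately show ?thesis
    by (simp add: complex_eq_iff)
qed

lemma norm_omega [simp]: "cmod (omega d) = 1"
  by (simp add: omega_def norm_exp_eq_Re)

text \<open>Dividing the quadratic relation for \<open>F\<close> by \<open>F i\<close> shows that
  \<open>F\<close> has a single nonzero value, and likewise \<open>G\<close>. Each total is thus a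
  support size times the other total over \<open>s\<close>; going round once returns the sum of
  \<open>F\<close> multiplied by the product of the two support sizes over \<open>s\<close>
  squared.\<close>

lemma constant_on_support_card_mult:
  fixes F G :: "'i \<Rightarrow> real"
  assumes fin: "finite A" and s: "0 < s"
    and F: "\<And>i. i \<in> A \<Longrightarrow> (F i)\<^sup>2 = F i * (\<Sum>j\<in>A. G j) / s"
    and G: "\<And>j. j \<in> A \<Longrightarrow> (G j)\<^sup>2 = G j * (\<Sum>i\<in>A. F i) / s"
    and nz: "(\<Sum>i\<in>A. F i) \<noteq> 0"
  shows "real (card {i\<in>A. F i \<noteq> 0} * card {j\<in>A. G j \<noteq> 0}) = s\<^sup>2"
proof -
  have support: "(\<Sum>i\<in>A. f i) = real (card {i\<in>A. f i \<noteq> 0}) * (c / s)"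
    if "\<And>i. i \<in> A \<Longrightarrow> (f i)\<^sup>2 = f i * c / s" for f :: "'i \<Rightarrow> real" and c
  proof -
    have "(\<Sum>i\<in>A. f i) = (\<Sum>i\<in>{i\<in>A. f i \<noteq> 0}. f i)"
      using fin by (auto intro!: sum.mono_neutral_right)
    also have "\<dots> = (\<Sum>i\<in>{i\<in>A. f i \<noteq> 0}. c / s)"
    proof (intro sum.cong refl)
      fix i assume i: "i \<in> {i\<in>A. f i \<noteq> 0}"
      then have "f i * f i = f i * (c / s)"
        using that[of i] by (simp add: power2_eq_square)
      with i show "f i = c / s"
        using mult_left_cancel[of "f i"] by blast
    qed
    finally show ?thesis
      by simp
  qed
  let ?m = "real (card {i\<in>A. F i \<noteq> 0})" and ?n = "real (card {j\<in>A. G j \<noteq> 0})"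
  have "(\<Sum>i\<in>A. F i) = ?m * ((\<Sum>j\<in>A. G j) / s)"
    using F by (rule support)
  moreover have "(\<Sum>j\<in>A. G j) = ?n * ((\<Sum>i\<in>A. F i) / s)"
    using G by (rule support)
  ultimately have "(\<Sum>i\<in>A. F i) = ?m * (?n * ((\<Sum>i\<in>A. F i) / s) / s)"
    by (rule subst[rotated])
  then have "(\<Sum>i\<in>A. F i) * s\<^sup>2 = (\<Sum>i\<in>A. F i) * (?m * ?n)"
    using s by (simp add: power2_eq_square eq_divide_eq mult_ac)
  with nz show ?thesis
    by simp
qed

section \<open>Resolution of the identity and the marginals of the KD distribution\<close>

context complex_inner_product_space
begin

lemma braket_zero_right [simp]: "braket x 0 = 0"
  using braket_add_right[of x 0 0] by simp

text \<open>Both sides are linear in \<open>y\<close>, so induction over the span reduces the claim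
  to \<open>y\<close> a basis vector, where orthonormality leaves one term of the sum.\<close>

lemma orthonormal_basis_completeness:
  assumes "orthonormal_basis scale braket d e"
  shows "(\<Sum>k<d. braket x (e k) * braket (e k) y) = braket x y"
proof -
  have orth: "braket (e i) (e j) = (if i = j then 1 else 0)" if "i < d" "j < d" for i j
    using assms that unfolding orthonormal_basis_def by blast
  have "y \<in> span (e ` {..<d})"
    using assms unfolding orthonormal_basis_def by simp
  then show ?thesis
  proof (induction rule: span_induct_alt)
    case base
    then show ?case by simp
  next
    case (step c z y)
    then obtain i where i: "i < d" "z = e i"
      by auto
    then have "(\<Sum>k<d. braket x (e k) * braket (e k) z) = braket x z"
      by (simp add: orth if_distrib cong: if_cong)
    moreover have "(\<Sum>k<d. braket x (e k) * braket (e k) (scale c z + y)) =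
        c * (\<Sum>k<d. braket x (e k) * braket (e k) z) + (\<Sum>k<d. braket x (e k) * braket (e k) y)"
      by (simp add: braket_add_right braket_scale_right sum.distrib sum_distrib_left algebra_simps)
    ultimately show ?case
      using step by (simp add: braket_add_right braket_scale_right)
  qed
qed

lemma braket_mult_commute: "braket x y * braket y x = complex_of_real ((cmod (braket x y))\<^sup>2)"
  using braket_commute[of y x] by (simp only: complex_norm_square)

lemma KD_distribution_row_sum:
  assumes "orthonormal_basis scale braket d b"
  shows "(\<Sum>j<d. KD_distribution braket a b \<psi> i j) = complex_of_real ((cmod (braket (a i) \<psi>))\<^sup>2)"
proof -
  have "(\<Sum>j<d. KD_distribution braket a b \<psi> i j) = braket (a i) \<psi> * braket \<psi> (a i)"
    \<comment> \<open>Completeness is read backwards: it inserts the basis \<open>b\<close> between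
      \<open>\<psi>\<close> and \<open>a i\<close>.\<close>
    unfolding KD_distribution_def orthonormal_basis_completeness[OF assms, symmetric, of \<psi> "a i"]
    by (simp add: sum_distrib_left mult.assoc)
  then show ?thesis
    by (simp add: braket_mult_commute)
qed

lemma KD_distribution_col_sum:
  assumes "orthonormal_basis scale braket d a"
  shows "(\<Sum>i<d. KD_distribution braket a b \<psi> i j) = complex_of_real ((cmod (braket (b j) \<psi>))\<^sup>2)"
proof -
  have "(\<Sum>i<d. KD_distribution braket a b \<psi> i j) = braket (b j) \<psi> * braket \<psi> (b j)"
    unfolding KD_distribution_def orthonormal_basis_completeness[OF assms, symmetric, of "b j" \<psi>]
    by (simp add: sum_distrib_left sum_distrib_right mult_ac)
  then show ?thesis
    by (simp add: braket_mult_commute)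
qed

text \<open>Parseval's identity, that is, completeness with both arguments equal to
  \<open>\<psi>\<close>.\<close>

lemma sum_cmod_braket_square:
  assumes "orthonormal_basis scale braket d e" and "is_state braket \<psi>"
  shows "(\<Sum>k<d. (cmod (braket (e k) \<psi>))\<^sup>2) = 1"
proof -
  have "complex_of_real (\<Sum>k<d. (cmod (braket (e k) \<psi>))\<^sup>2) = braket \<psi> \<psi>"
    unfolding orthonormal_basis_completeness[OF assms(1), symmetric, of \<psi> \<psi>] of_real_sum
    by (intro sum.cong refl) (metis braket_mult_commute mult.commute)
  with assms(2) show ?thesis
    unfolding is_state_def by (metis of_real_eq_1_iff)
qed

lemma sum_cmod_braket_square_le:
  assumes "orthonormal_basis scale braket d e" and "is_state braket \<psi>"
  shows "(\<Sum>k<d. cmod (braket (e k) \<psi>))\<^sup>2 \<le> real (support_size braket d e \<psi>)"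
  using sum_squared_le_card_support[of "{..<d}" "\<lambda>k. cmod (braket (e k) \<psi>)"]
  by (simp add: sum_cmod_braket_square[OF assms] support_size_def)

text \<open>Being real and nonnegative becomes one equation, the form in which the equality case of
  the triangle inequality delivers classicality.\<close>

lemma KD_classical_iff_cmod:
  "KD_classical braket d a b \<psi> \<longleftrightarrow>
    (\<forall>i<d. \<forall>j<d. KD_distribution braket a b \<psi> i j =
      complex_of_real (cmod (KD_distribution braket a b \<psi> i j)))"
  unfolding KD_classical_def complex_eq_cmod_iff ..

section \<open>Mutually unbiased bases: the support uncertainty relation and its equality
  case\<close>

context
  fixes d :: nat and a b :: "nat \<Rightarrow> 'h" and \<psi> :: 'h
  assumes d: "d \<ge> 1"
    and a: "orthonormal_basis scale braket d a"
    and b: "orthonormal_basis scale braket d b"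
    and unbiased: "\<And>i j. i < d \<Longrightarrow> j < d \<Longrightarrow> cmod (braket (a i) (b j)) = 1 / sqrt d"
    and state: "is_state braket \<psi>"
begin

lemma cmod_KD_distribution:
  assumes "i < d" "j < d"
  shows "cmod (KD_distribution braket a b \<psi> i j) =
    cmod (braket (a i) \<psi>) * cmod (braket (b j) \<psi>) / sqrt d"
  using unbiased[OF assms] braket_commute[of "b j" "a i"] braket_commute[of \<psi> "b j"]
  by (simp add: KD_distribution_def norm_mult)

lemma sum_KD_distribution: "(\<Sum>(i, j)\<in>{..<d} \<times> {..<d}. KD_distribution braket a b \<psi> i j) = 1"
proof -
  have "(\<Sum>i<d. \<Sum>j<d. KD_distribution braket a b \<psi> i j) =
      complex_of_real (\<Sum>i<d. (cmod (braket (a i) \<psi>))\<^sup>2)"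
    by (simp only: KD_distribution_row_sum[OF b] of_real_sum)
  then show ?thesis
    by (simp add: sum_cmod_braket_square[OF a state] sum.cartesian_product)
qed

lemma sum_cmod_KD_distribution_square_le:
  "(\<Sum>(i, j)\<in>{..<d} \<times> {..<d}. cmod (KD_distribution braket a b \<psi> i j))\<^sup>2 \<le>
    real (support_size braket d a \<psi> * support_size braket d b \<psi>) / d"
proof -
  have "(\<Sum>(i, j)\<in>{..<d} \<times> {..<d}. cmod (KD_distribution braket a b \<psi> i j)) =
      (\<Sum>i<d. \<Sum>j<d. cmod (braket (a i) \<psi>) * cmod (braket (b j) \<psi>) / sqrt d)"
    by (simp add: cmod_KD_distribution flip: sum.cartesian_product)
  \<comment> \<open>Since the modulus of \<open>Q\<close> is a product of a function of
    \<open>i\<close> and a function of \<open>j\<close>, the double sum factorises and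
    Cauchy-Schwarz applies to each factor separately.\<close>
  also have "\<dots> = (\<Sum>i<d. cmod (braket (a i) \<psi>)) * (\<Sum>j<d. cmod (braket (b j) \<psi>)) / sqrt d"
    by (simp add: sum_product sum_divide_distrib)
  finally have "(\<Sum>(i, j)\<in>{..<d} \<times> {..<d}. cmod (KD_distribution braket a b \<psi> i j))\<^sup>2 =
      (\<Sum>i<d. cmod (braket (a i) \<psi>))\<^sup>2 * (\<Sum>j<d. cmod (braket (b j) \<psi>))\<^sup>2 / d"
    by (simp add: power_mult_distrib power_divide)
  also have "\<dots> \<le> real (support_size braket d a \<psi> * support_size braket d b \<psi>) / d"
    using sum_cmod_braket_square_le[OF a state] sum_cmod_braket_square_le[OF b state]
    by (auto intro!: divide_right_mono mult_mono)
  finally show ?thesis .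
qed

lemma support_size_uncertainty: "d \<le> support_size braket d a \<psi> * support_size braket d b \<psi>"
proof -
  have "1 = cmod (\<Sum>(i, j)\<in>{..<d} \<times> {..<d}. KD_distribution braket a b \<psi> i j)"
    by (simp add: sum_KD_distribution)
  also have "\<dots> \<le> (\<Sum>(i, j)\<in>{..<d} \<times> {..<d}. cmod (KD_distribution braket a b \<psi> i j))"
    by (rule sum_norm_le) auto
  finally have "1 \<le> (\<Sum>(i, j)\<in>{..<d} \<times> {..<d}. cmod (KD_distribution braket a b \<psi> i j))\<^sup>2"
    by (rule one_le_power)
  also note sum_cmod_KD_distribution_square_le
  finally have "real d \<le> real (support_size braket d a \<psi> * support_size braket d b \<psi>)"
    using d by (simp add: field_simps)
  then show ?thesis
    by (simp only: of_nat_le_iff)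
qed

lemma KD_classical_if_support_size:
  assumes "support_size braket d a \<psi> * support_size braket d b \<psi> = d"
  shows "KD_classical braket d a b \<psi>"
proof -
  let ?Q = "\<lambda>(i, j). KD_distribution braket a b \<psi> i j"
  have "(\<Sum>p\<in>{..<d} \<times> {..<d}. cmod (?Q p))\<^sup>2 \<le> 1\<^sup>2"
    using sum_cmod_KD_distribution_square_le assms d by (simp add: case_prod_unfold)
  then have "(\<Sum>p\<in>{..<d} \<times> {..<d}. cmod (?Q p)) \<le> 1"
    by (rule power2_le_imp_le) simp
  \<comment> \<open>The bound 1 is itself the total of \<open>Q\<close>, so the triangle inequality
    is tight.\<close>
  then have "(\<Sum>p\<in>{..<d} \<times> {..<d}. cmod (?Q p)) \<le> Re (\<Sum>p\<in>{..<d} \<times> {..<d}. ?Q p)"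
    by (simp add: sum_KD_distribution)
  then have "?Q p = complex_of_real (cmod (?Q p))" if "p \<in> {..<d} \<times> {..<d}" for p
    using that by (intro eq_cmod_if_sum_cmod_le_Re_sum) auto
  then show ?thesis
    unfolding KD_classical_iff_cmod by force
qed

text \<open>Classicality removes the phases, so the row and column sums of \<open>Q\<close> become
  real identities in \<open>?F\<close> and \<open>?G\<close>: the quadratic relations of
  \<open>constant_on_support_card_mult\<close> with \<open>s\<close> equal to
  \<open>sqrt d\<close>.\<close>

lemma support_size_if_KD_classical:
  assumes "KD_classical braket d a b \<psi>"
  shows "support_size braket d a \<psi> * support_size braket d b \<psi> = d"
proof -
  let ?F = "\<lambda>i. cmod (braket (a i) \<psi>)" and ?G = "\<lambda>j. cmod (braket (b j) \<psi>)"
  have Q: "KD_distribution braket a b \<psi> i j = complex_of_real (?F i * ?G j / sqrt d)"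
    if "i < d" "j < d" for i j
    using assms that unfolding KD_classical_iff_cmod cmod_KD_distribution[OF that, symmetric] by blast
  have F: "(?F i)\<^sup>2 = ?F i * (\<Sum>j<d. ?G j) / sqrt d" if "i \<in> {..<d}" for i
  proof -
    have "complex_of_real ((?F i)\<^sup>2) = complex_of_real (\<Sum>j<d. ?F i * ?G j / sqrt d)"
      using that unfolding of_real_sum KD_distribution_row_sum[OF b, of a \<psi> i, symmetric]
      by (intro sum.cong) (simp_all add: Q)
    then show ?thesis
      by (simp only: of_real_eq_iff sum_distrib_left sum_divide_distrib)
  qed
  have G: "(?G j)\<^sup>2 = ?G j * (\<Sum>i<d. ?F i) / sqrt d" if "j \<in> {..<d}" for j
  proof -
    have "complex_of_real ((?G j)\<^sup>2) = complex_of_real (\<Sum>i<d. ?F i * ?G j / sqrt d)"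
      using that unfolding of_real_sum KD_distribution_col_sum[OF a, of b \<psi> j, symmetric]
      by (intro sum.cong) (simp_all add: Q)
    then show ?thesis
      by (simp only: of_real_eq_iff sum_distrib_left sum_divide_distrib mult.commute)
  qed
  \<comment> \<open>This total is cancelled in the final count; it is nonzero because the squares of
    \<open>?F\<close> sum to 1.\<close>
  have "(\<Sum>i<d. ?F i) \<noteq> 0"
  proof
    assume "(\<Sum>i<d. ?F i) = 0"
    then have "\<forall>i<d. ?F i = 0"
      by (subst (asm) sum_nonneg_eq_0_iff) auto
    then have "(\<Sum>i<d. (?F i)\<^sup>2) = 0"
      by simp
    then show False
      by (simp add: sum_cmod_braket_square[OF a state])
  qed
  then have "real (card {i\<in>{..<d}. ?F i \<noteq> 0} * card {j\<in>{..<d}. ?G j \<noteq> 0}) = (sqrt d)\<^sup>2"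
    using F G d by (intro constant_on_support_card_mult) auto
  then show ?thesis
    unfolding support_size_def by (simp flip: of_nat_mult)
qed

end

end

theorem theorem4:
  fixes scale :: "complex \<Rightarrow> 'h::ab_group_add \<Rightarrow> 'h"
    and braket :: "'h \<Rightarrow> 'h \<Rightarrow> complex"
    and d :: nat
    and a b :: "nat \<Rightarrow> 'h"
    and \<psi> :: 'h
  assumes "complex_inner_product_space scale braket"
    and "d \<ge> 1"
    and "vector_space.dim scale (UNIV :: 'h set) = d"
    and "orthonormal_basis scale braket d a"
    and "orthonormal_basis scale braket d b"
    and "\<And>i j. i < d \<Longrightarrow> j < d \<Longrightarrow>
           braket (a i) (b j) = 1 / complex_of_real (sqrt (real d)) * omega d ^ (i * j)"
    and "is_state braket \<psi>"
  shows "(KD_nonclassical braket d a b \<psi> \<longleftrightarrow>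
            support_size braket d a \<psi> * support_size braket d b \<psi> > d) \<and>
         (KD_classical braket d a b \<psi> \<longleftrightarrow>
            support_size braket d a \<psi> * support_size braket d b \<psi> = d)"
proof -
  interpret complex_inner_product_space scale braket
    by fact
  have unbiased: "cmod (braket (a i) (b j)) = 1 / sqrt d" if "i < d" "j < d" for i j
    using assms(6)[OF that] by (simp add: norm_mult norm_divide norm_power)
  note mub = \<open>d \<ge> 1\<close> assms(4,5) unbiased \<open>is_state braket \<psi>\<close>
  have "KD_classical braket d a b \<psi> \<longleftrightarrow>
      support_size braket d a \<psi> * support_size braket d b \<psi> = d"
    using KD_classical_if_support_size[OF mub] support_size_if_KD_classical[OF mub] by blast
  \<comment> \<open>The product is never below \<open>d\<close>, so differing from \<open>d\<close>
    means exceeding it.\<close>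
  with support_size_uncertainty[OF mub] show ?thesis
    unfolding KD_nonclassical_def by linarith
qed

end
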